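(* Let $(P,r)$ be a finite graded poset of rank $n$ that is shellable, i.e. its order complex $\varDelta(P)$ is shellable. Then for every $0\le k\le n$ the complex $\varDelta^{(k)}(P)$ is shellable.
   Context: A finite poset $P$ is graded of rank $n\ge 0$ if every maximal chain has length $n$ (i.e. $n+1$ elements); its rank function $r$ satisfies $r(x)=0$ for $x$ minimal and $r(y)=r(x)+1$ if $y$ covers $x$. The order complex $\varDelta(P)$ is the abstract simplicial complex whose simplices are the chains of $P$, and $\varDelta^{(k)}(P)=\{(x_0<\cdots<x_l)\mid r(x_l)-r(x_0)\le k\}\subseteq\varDelta(P)$. A finite simplicial complex is pure of dimension $m$ if all its maximal simplices have dimension $m$. A finite simplicial complex $\varDelta$ is shellable if its maximal simplices can be linearly ordered $F_1,\dots,F_t$ so that for every $j=2,\dots,t$ the subcomplex $\bigl(\bigcup_{i=1}^{j-1}F_i\bigr)\cap F_j$ (where each $F_i$ is regarded as the complex of all its faces) is pure of dimension $\dim F_j-1$. The empty simplex is regarded as having dimension $-1$, so that the complex $\{\emptyset\}$ is pure of dimension $-1$. *)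

theory Defs
  imports Main
begin

(* Complexes are abstract and contain the empty simplex, which has dimension -1; hence integer
   dimensions. *)

definition simplicial_complex :: "'a set set \<Rightarrow> bool" where
  "simplicial_complex \<Delta> \<longleftrightarrow> {} \<in> \<Delta> \<and> (\<forall>F\<in>\<Delta>. finite F \<and> (\<forall>G. G \<subseteq> F \<longrightarrow> G \<in> \<Delta>))"

definition facets :: "'a set set \<Rightarrow> 'a set set" where
  "facets \<Delta> = {F \<in> \<Delta>. \<forall>G\<in>\<Delta>. F \<subseteq> G \<longrightarrow> G = F}"

definition dim_simplex :: "'a set \<Rightarrow> int" where
  "dim_simplex F = int (card F) - 1"

definition pure_complex :: "int \<Rightarrow> 'a set set \<Rightarrow> bool" where
  "pure_complex m \<Delta> \<longleftrightarrow> (\<forall>F\<in>facets \<Delta>. dim_simplex F = m)"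

(* The list Fs is indexed from 0, so its second entry is Fs ! 1;
   Pow F is the simplex F regarded as the complex of all its faces. *)
definition shelling :: "'a set set \<Rightarrow> 'a set list \<Rightarrow> bool" where
  "shelling \<Delta> Fs \<longleftrightarrow> distinct Fs \<and> set Fs = facets \<Delta> \<and>
     (\<forall>j. 1 \<le> j \<and> j < length Fs \<longrightarrow>
        pure_complex (dim_simplex (Fs ! j) - 1) ((\<Union>i<j. Pow (Fs ! i)) \<inter> Pow (Fs ! j)))"

definition shellable :: "'a set set \<Rightarrow> bool" where
  "shellable \<Delta> \<longleftrightarrow> finite \<Delta> \<and> simplicial_complex \<Delta> \<and> (\<exists>Fs. shelling \<Delta> Fs)"

(* In a poset P with order relation le, (x, y) \<in> le means x \<le> y. *)

definition minimal_in :: "'a set \<Rightarrow> 'a rel \<Rightarrow> 'a \<Rightarrow> bool" where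
  "minimal_in P le x \<longleftrightarrow> x \<in> P \<and> (\<forall>z\<in>P. (z, x) \<in> le \<longrightarrow> z = x)"

definition covers :: "'a set \<Rightarrow> 'a rel \<Rightarrow> 'a \<Rightarrow> 'a \<Rightarrow> bool" where
  "covers P le y x \<longleftrightarrow> x \<in> P \<and> y \<in> P \<and> (x, y) \<in> le \<and> x \<noteq> y \<and>
     (\<forall>z\<in>P. (x, z) \<in> le \<and> (z, y) \<in> le \<longrightarrow> z = x \<or> z = y)"

definition order_complex :: "'a set \<Rightarrow> 'a rel \<Rightarrow> 'a set set" where
  "order_complex P le = {C \<in> Chains le. C \<subseteq> P}"

(* The facets of the order complex are the maximal chains; a chain of length n has n + 1 elements. *)
definition graded_poset :: "'a set \<Rightarrow> 'a rel \<Rightarrow> ('a \<Rightarrow> nat) \<Rightarrow> nat \<Rightarrow> bool" where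
  "graded_poset P le r n \<longleftrightarrow>
     finite P \<and> partial_order_on P le \<and>
     (\<forall>C\<in>facets (order_complex P le). card C = n + 1) \<and>
     (\<forall>x. minimal_in P le x \<longrightarrow> r x = 0) \<and>
     (\<forall>x y. covers P le y x \<longrightarrow> r y = r x + 1)"

(* For a nonempty chain C, the elements x and y below are its least and greatest elements;
   the empty chain always belongs to the complex. *)
definition truncated_order_complex ::
    "'a set \<Rightarrow> 'a rel \<Rightarrow> ('a \<Rightarrow> nat) \<Rightarrow> nat \<Rightarrow> 'a set set" where
  "truncated_order_complex P le r k = {C \<in> order_complex P le.
     \<forall>x\<in>C. \<forall>y\<in>C. (\<forall>z\<in>C. (x, z) \<in> le \<and> (z, y) \<in> le) \<longrightarrow> int (r y) - int (r x) \<le> int k}"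

end

theory Submission
  imports Defs
begin

text \<open>
  Write \<open>F[i]\<close> for the part of a maximal chain \<open>F\<close> with ranks in \<open>{i..i + k}\<close>. The facets of the
  truncation are the sets \<open>F[i]\<close> with \<open>i \<le> n - k\<close>. Given a shelling \<open>F\<^sub>0, F\<^sub>1, \<dots>\<close> of the order complex,
  list them lexicographically by \<open>(j, i)\<close>, where \<open>i\<close> is the least rank and \<open>j\<close> is the first index
  such that \<open>F\<^sub>j\<close> contains the facet. If \<open>H\<close> precedes \<open>G = F\<^sub>j[i]\<close> because it lies in an earlier \<open>F\<^sub>l\<close>, then
  \<open>F\<^sub>l \<inter> F\<^sub>j \<subseteq> F\<^sub>j - {x} \<subseteq> F\<^sub>m\<close> for some \<open>m < j\<close>; minimality of \<open>j\<close> forces \<open>x \<in> G\<close>, and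
  \<open>H \<inter> G \<subseteq> G - {x} \<subseteq> F\<^sub>m[i]\<close>. If instead \<open>H = F\<^sub>j[h]\<close> with \<open>h < i\<close>, then \<open>H\<close> misses the top \<open>x\<close> of \<open>G\<close> and
  \<open>H \<inter> G \<subseteq> G - {x} \<subseteq> F\<^sub>j[i - 1]\<close>.
\<close>

section \<open>Shellings and the exchange property\<close>

lemma facet_extension:
  assumes "finite \<Delta>" "C \<in> \<Delta>"
  obtains F where "F \<in> facets \<Delta>" "C \<subseteq> F"
proof -
  obtain F where F: "F \<in> \<Delta>" "C \<subseteq> F" "\<forall>G\<in>\<Delta>. F \<subseteq> G \<longrightarrow> F = G"
    using finite_has_maximal2[OF assms] by auto
  then have "F \<in> facets \<Delta>"
    unfolding facets_def by auto
  with that F(2) show thesis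
    by blast
qed

text \<open>The common face of \<open>Fs ! l\<close> and \<open>Fs ! j\<close> extends to a facet of
  the intersection complex. Purity gives that facet one vertex fewer than \<open>Fs ! j\<close>, so
  it has the form \<open>Fs ! j - {x}\<close>, and it lies in some earlier
  \<open>Fs ! m\<close>.\<close>

lemma shelling_exchange:
  assumes "shelling \<Delta> Fs" and fin: "\<And>F. F \<in> facets \<Delta> \<Longrightarrow> finite F"
    and "l < j" "j < length Fs"
  obtains x m where "x \<in> Fs ! j" "m < j" "Fs ! l \<inter> Fs ! j \<subseteq> Fs ! j - {x}" "Fs ! j - {x} \<subseteq> Fs ! m"
proof -
  let ?D = "(\<Union>i<j. Pow (Fs ! i)) \<inter> Pow (Fs ! j)"
  have finj: "finite (Fs ! j)"
    using assms nth_mem unfolding shelling_def by blast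
  have "finite ?D"
    using finj by simp
  moreover have "Fs ! l \<inter> Fs ! j \<in> ?D"
    using \<open>l < j\<close> by auto
  ultimately obtain E where E: "E \<in> facets ?D" "Fs ! l \<inter> Fs ! j \<subseteq> E"
    by (rule facet_extension)
  have "pure_complex (dim_simplex (Fs ! j) - 1) ?D"
    using assms unfolding shelling_def by auto
  with E have card: "int (card E) = int (card (Fs ! j)) - 1"
    unfolding pure_complex_def dim_simplex_def by auto
  from E obtain m where m: "m < j" "E \<subseteq> Fs ! m" and sub: "E \<subseteq> Fs ! j"
    unfolding facets_def by auto
  have "card (Fs ! j - E) = 1"
    using card sub finj by (simp add: card_Diff_subset finite_subset)
  then obtain x where "Fs ! j - E = {x}"
    by (auto simp: card_1_singleton_iff)
  with sub have "x \<in> Fs ! j" "E = Fs ! j - {x}"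
    by auto
  with that m E show thesis
    by blast
qed

text \<open>A converse to the exchange property, with the order given by a numerical key rather than
  a list. Any face of \<open>G\<close> shared with an earlier \<open>H\<close> lies in
  \<open>G - {x}\<close>, which is itself shared with the earlier \<open>K\<close>; hence the facets
  of the intersection complex all have codimension one in \<open>G\<close>.\<close>

lemma shellable_of_key:
  fixes key :: "'a set \<Rightarrow> nat"
  assumes "finite \<Delta>" "simplicial_complex \<Delta>" and inj: "inj_on key (facets \<Delta>)"
    and exch: "\<And>G H. G \<in> facets \<Delta> \<Longrightarrow> H \<in> facets \<Delta> \<Longrightarrow> key H < key G \<Longrightarrow>
      \<exists>x\<in>G. \<exists>K\<in>facets \<Delta>. key K < key G \<and> H \<inter> G \<subseteq> G - {x} \<and> G - {x} \<subseteq> K"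
  shows "shellable \<Delta>"
proof -
  have "finite (facets \<Delta>)"
    using \<open>finite \<Delta>\<close> unfolding facets_def by simp
  then obtain xs where xs: "set xs = facets \<Delta>" "distinct xs"
    using finite_distinct_list by blast
  define Gs where "Gs = sort_key key xs"
  have set: "set Gs = facets \<Delta>" and dist: "distinct Gs"
    using xs by (auto simp: Gs_def)
  \<comment> \<open>Injectivity of \<open>key\<close> makes the sorted order strict, so positions in
    \<open>Gs\<close> and key values can be exchanged in both directions.\<close>
  have "distinct (map key Gs)"
    using inj set dist by (simp add: distinct_map)
  moreover have "sorted (map key Gs)"
    by (simp add: Gs_def)
  ultimately have "sorted_wrt (<) (map key Gs)"
    by (simp add: strict_sorted_iff)
  then have less: "key (Gs ! i) < key (Gs ! j)" if "i < j" "j < length Gs" for i j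
    using that by (auto simp: sorted_wrt_iff_nth_less)
  have idx: "\<exists>i<j. K = Gs ! i" if K: "K \<in> facets \<Delta>" "key K < key (Gs ! j)" "j < length Gs" for K j
  proof -
    obtain i where i: "i < length Gs" "K = Gs ! i"
      using K(1) set by (metis in_set_conv_nth)
    moreover have "i < j"
      using less[of j i] K(2) i by (cases i j rule: linorder_cases) auto
    ultimately show ?thesis by blast
  qed
  have "pure_complex (dim_simplex (Gs ! j) - 1) ((\<Union>i<j. Pow (Gs ! i)) \<inter> Pow (Gs ! j))"
    if j: "j < length Gs" for j
    unfolding pure_complex_def
  proof
    let ?D = "(\<Union>i<j. Pow (Gs ! i)) \<inter> Pow (Gs ! j)"
    fix E assume E: "E \<in> facets ?D"
    then obtain i where i: "i < j" "E \<subseteq> Gs ! i" "E \<subseteq> Gs ! j"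
      unfolding facets_def by auto
    have facets: "Gs ! j \<in> facets \<Delta>" "Gs ! i \<in> facets \<Delta>"
      using i j set by (metis nth_mem order.strict_trans)+
    obtain x K where xK: "x \<in> Gs ! j" "K \<in> facets \<Delta>" "key K < key (Gs ! j)"
      "Gs ! i \<inter> Gs ! j \<subseteq> Gs ! j - {x}" "Gs ! j - {x} \<subseteq> K"
      using exch[OF facets less[OF i(1) j]] by blast
    obtain m where "m < j" "K = Gs ! m"
      using idx xK j by blast
    then have "Gs ! j - {x} \<in> ?D"
      using xK by auto
    moreover have "E \<subseteq> Gs ! j - {x}"
      using i xK by blast
    ultimately have "E = Gs ! j - {x}"
      using E unfolding facets_def by blast
    moreover have "finite (Gs ! j)"
      using facets \<open>simplicial_complex \<Delta>\<close> unfolding facets_def simplicial_complex_def by blast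
    ultimately have "card (Gs ! j) = Suc (card E)"
      using xK card.remove by metis
    then show "dim_simplex E = dim_simplex (Gs ! j) - 1"
      unfolding dim_simplex_def by simp
  qed
  then have "shelling \<Delta> Gs"
    using set dist unfolding shelling_def by blast
  with assms show ?thesis
    unfolding shellable_def by blast
qed

section \<open>Graded posets\<close>

locale graded =
  fixes P :: "'a set" and le :: "'a rel" and r :: "'a \<Rightarrow> nat" and n :: nat
  assumes graded: "graded_poset P le r n"
begin

lemma finite_P: "finite P"
  using graded unfolding graded_poset_def by blast

lemma partial_order: "partial_order_on P le"
  using graded unfolding graded_poset_def by blast

lemma refl: "x \<in> P \<Longrightarrow> (x, x) \<in> le"
  using partial_order_onD(1)[OF partial_order] by (rule refl_onD)

lemma trans: "(x, y) \<in> le \<Longrightarrow> (y, z) \<in> le \<Longrightarrow> (x, z) \<in> le"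
  using partial_order_onD(2)[OF partial_order] by (rule transD)

lemma antisym: "(x, y) \<in> le \<Longrightarrow> (y, x) \<in> le \<Longrightarrow> x = y"
  using partial_order_onD(3)[OF partial_order] by (rule antisymD)

section \<open>Chains and maximal chains\<close>

lemma chain_finite: "C \<in> order_complex P le \<Longrightarrow> finite C"
  unfolding order_complex_def by (auto intro: finite_subset[OF _ finite_P])

lemma finite_order_complex: "finite (order_complex P le)"
  by (rule finite_subset[of _ "Pow P"]) (auto simp: order_complex_def finite_P)

lemma chain_subset: "C \<in> order_complex P le \<Longrightarrow> D \<subseteq> C \<Longrightarrow> D \<in> order_complex P le"
  unfolding order_complex_def Chains_def by blast

lemma maximal_chain_chain: "C \<in> facets (order_complex P le) \<Longrightarrow> C \<in> order_complex P le"
  unfolding facets_def by blast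

lemma chain_subset_P: "C \<in> order_complex P le \<Longrightarrow> C \<subseteq> P"
  unfolding order_complex_def by blast

lemma chain_comparable:
  "C \<in> order_complex P le \<Longrightarrow> x \<in> C \<Longrightarrow> y \<in> C \<Longrightarrow> (x, y) \<in> le \<or> (y, x) \<in> le"
  unfolding order_complex_def Chains_def by blast

lemma maximal_chain_mem:
  assumes C: "C \<in> facets (order_complex P le)" and "z \<in> P"
    and "\<And>x. x \<in> C \<Longrightarrow> (x, z) \<in> le \<or> (z, x) \<in> le"
  shows "z \<in> C"
proof -
  have "insert z C \<in> order_complex P le"
    using maximal_chain_chain[OF C] assms(2,3) refl
    unfolding order_complex_def Chains_def by blast
  with C show ?thesis
    unfolding facets_def by blast
qed

lemma chain_max:
  assumes "C \<in> order_complex P le" "C \<noteq> {}"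
  obtains m where "m \<in> C" "\<And>x. x \<in> C \<Longrightarrow> (x, m) \<in> le"
proof -
  have "\<exists>m\<in>C. \<forall>x\<in>C. (x, m) \<in> le"
    using chain_finite[OF assms(1)] assms(2,1)
  proof (induction rule: finite_ne_induct)
    case (singleton x)
    then show ?case using refl chain_subset_P by blast
  next
    case (insert a C)
    then obtain m where m: "m \<in> C" "\<forall>x\<in>C. (x, m) \<in> le"
      using chain_subset by (metis subset_insertI)
    have "(a, m) \<in> le \<or> (m, a) \<in> le" "(a, a) \<in> le"
      using chain_comparable[OF insert.prems] m refl chain_subset_P[OF insert.prems] by blast+
    then show ?case
      using m trans by (metis insert_iff)
  qed
  with that show thesis by blast
qed

lemma chain_min:
  assumes "C \<in> order_complex P le" "C \<noteq> {}"
  obtains m where "m \<in> C" "\<And>x. x \<in> C \<Longrightarrow> (m, x) \<in> le"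
proof -
  have "\<exists>m\<in>C. \<forall>x\<in>C. (m, x) \<in> le"
    using chain_finite[OF assms(1)] assms(2,1)
  proof (induction rule: finite_ne_induct)
    case (singleton x)
    then show ?case using refl chain_subset_P by blast
  next
    case (insert a C)
    then obtain m where m: "m \<in> C" "\<forall>x\<in>C. (m, x) \<in> le"
      using chain_subset by (metis subset_insertI)
    have "(a, m) \<in> le \<or> (m, a) \<in> le" "(a, a) \<in> le"
      using chain_comparable[OF insert.prems] m refl chain_subset_P[OF insert.prems] by blast+
    then show ?case
      using m trans by (metis insert_iff)
  qed
  with that show thesis by blast
qed

text \<open>The grading fixes \<open>r\<close> only at minimal elements and along covers. By
  maximality of \<open>C\<close>, its bottom is minimal in all of \<open>P\<close> and its
  consecutive elements are covers in \<open>P\<close>, so the rank can be counted by climbing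
  \<open>C\<close>.\<close>

lemma rank_eq_card_below:
  assumes C: "C \<in> facets (order_complex P le)" and "c \<in> C"
  shows "r c = card {x \<in> C. (x, c) \<in> le \<and> x \<noteq> c}"
  using \<open>c \<in> C\<close>
proof (induction "card {x \<in> C. (x, c) \<in> le \<and> x \<noteq> c}" arbitrary: c rule: less_induct)
  case less
  let ?B = "\<lambda>c. {x \<in> C. (x, c) \<in> le \<and> x \<noteq> c}"
  note chain = maximal_chain_chain[OF C]
  have "c \<in> P"
    using chain_subset_P[OF chain] less.prems by blast
  show ?case
  proof (cases "?B c = {}")
    case True
    have min: "(c, x) \<in> le" if "x \<in> C" for x
      using True chain_comparable[OF chain that less.prems] refl[OF \<open>c \<in> P\<close>] that by blast
    \<comment> \<open>Anything below the least element of \<open>C\<close> is comparable to all of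
      \<open>C\<close>, hence already belongs to \<open>C\<close>.\<close>
    have "z = c" if "z \<in> P" "(z, c) \<in> le" for z
    proof -
      have "z \<in> C"
        using maximal_chain_mem[OF C that(1)] trans[OF that(2)] min by blast
      then show ?thesis
        using min that antisym by blast
    qed
    then have "minimal_in P le c"
      using \<open>c \<in> P\<close> unfolding minimal_in_def by blast
    then show ?thesis
      using graded True unfolding graded_poset_def by (metis card.empty)
  next
    case False
    then obtain b where b: "b \<in> ?B c" "\<And>x. x \<in> ?B c \<Longrightarrow> (x, b) \<in> le"
      using chain_max[of "?B c"] chain_subset[OF chain] by (metis (no_types, lifting) mem_Collect_eq subsetI)
    have eq: "?B c = insert b (?B b)"
      using b trans antisym by blast
    have fin: "finite (?B b)"
      using chain_finite[OF chain] by simp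
    have card: "card (?B c) = Suc (card (?B b))"
      unfolding eq using fin by simp
    have "covers P le c b"
      unfolding covers_def
    proof (intro conjI ballI impI)
      fix z assume z: "z \<in> P" "(b, z) \<in> le \<and> (z, c) \<in> le"
      \<comment> \<open>Elements of \<open>C\<close> strictly below \<open>c\<close> lie below
        \<open>b\<close>, hence below \<open>z\<close>; the remaining ones lie above
        \<open>c\<close>, hence above \<open>z\<close>.\<close>
      have "(x, z) \<in> le \<or> (z, x) \<in> le" if "x \<in> C" for x
      proof (cases "x \<in> ?B c")
        case True
        then show ?thesis using b z trans by blast
      next
        case False
        then have "(c, x) \<in> le"
          using chain_comparable[OF chain that less.prems] that refl[OF \<open>c \<in> P\<close>] by blast
        then show ?thesis using z trans by blast
      qed
      then have "z \<in> C"
        using maximal_chain_mem[OF C z(1)] by blast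
      then show "z = b \<or> z = c"
        using b z antisym by blast
    qed (use b \<open>c \<in> P\<close> chain_subset_P[OF chain] in auto)
    then have "r c = r b + 1"
      using graded unfolding graded_poset_def by blast
    moreover have "r b = card (?B b)"
      using less.hyps[of b] card b by simp
    ultimately show ?thesis
      using card by simp
  qed
qed

lemma maximal_chain_card: "C \<in> facets (order_complex P le) \<Longrightarrow> card C = n + 1"
  using graded unfolding graded_poset_def by blast

text \<open>In a maximal chain through \<open>x\<close> and \<open>y\<close>, everything strictly
  below \<open>x\<close> is strictly below \<open>y\<close>, and \<open>x\<close> itself is counted
  only for \<open>y\<close>.\<close>

lemma rank_strict_mono:
  assumes "x \<in> P" "y \<in> P" "(x, y) \<in> le" "x \<noteq> y"
  shows "r x < r y"
proof -
  have "{x, y} \<in> order_complex P le"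
    using assms refl unfolding order_complex_def Chains_def by auto
  then obtain C where C: "C \<in> facets (order_complex P le)" "{x, y} \<subseteq> C"
    using facet_extension[OF finite_order_complex] by blast
  let ?B = "\<lambda>c. {x \<in> C. (x, c) \<in> le \<and> x \<noteq> c}"
  have "?B x \<subset> ?B y"
    using C assms trans antisym by blast
  moreover have "finite (?B y)"
    using chain_finite[OF maximal_chain_chain[OF C(1)]] by simp
  ultimately have "card (?B x) < card (?B y)"
    by (rule psubset_card_mono[rotated])
  then show ?thesis
    using rank_eq_card_below[OF C(1)] C(2) by simp
qed

lemma rank_mono: "x \<in> P \<Longrightarrow> y \<in> P \<Longrightarrow> (x, y) \<in> le \<Longrightarrow> r x \<le> r y"
  using rank_strict_mono[of x y] by (cases "x = y") auto

lemma chain_rank_inj: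
  assumes C: "C \<in> order_complex P le"
  shows "inj_on r C"
proof (rule inj_onI, rule ccontr)
  fix x y assume xy: "x \<in> C" "y \<in> C" "r x = r y" "x \<noteq> y"
  then have "x \<in> P" "y \<in> P"
    using chain_subset_P[OF C] by blast+
  with xy show False
    using chain_comparable[OF C xy(1,2)] rank_strict_mono[of x y] rank_strict_mono[of y x] by auto
qed

text \<open>An element is not strictly below itself, so its rank is less than the
  \<open>n + 1\<close> elements of the chain; injectivity and counting then force every value up to
  \<open>n\<close> to occur.\<close>

lemma maximal_chain_ranks:
  assumes C: "C \<in> facets (order_complex P le)"
  shows "bij_betw r C {0..n}"
proof -
  note chain = maximal_chain_chain[OF C]
  have "r c \<le> n" if "c \<in> C" for c
  proof -
    have "{x \<in> C. (x, c) \<in> le \<and> x \<noteq> c} \<subset> C"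
      using that by blast
    then have "r c < card C"
      unfolding rank_eq_card_below[OF C that] by (rule psubset_card_mono[OF chain_finite[OF chain]])
    then show ?thesis
      using maximal_chain_card[OF C] by simp
  qed
  then have "r ` C \<subseteq> {0..n}"
    by auto
  moreover have "card (r ` C) = card {0..n}"
    using card_image[OF chain_rank_inj[OF chain]] maximal_chain_card[OF C] by simp
  ultimately show ?thesis
    using chain_rank_inj[OF chain] unfolding bij_betw_def by (simp add: card_subset_eq)
qed

section \<open>Facets of the truncation\<close>

text \<open>Rank is monotone, so a bound between the least and greatest elements of a chain bounds
  all pairs. This form avoids mentioning extremal elements and covers the empty chain.\<close>

lemma truncated_iff:
  "C \<in> truncated_order_complex P le r k \<longleftrightarrow>
     C \<in> order_complex P le \<and> (\<forall>x\<in>C. \<forall>y\<in>C. r y \<le> r x + k)"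
proof (intro iffI conjI ballI)
  assume C: "C \<in> truncated_order_complex P le r k"
  then show chain: "C \<in> order_complex P le"
    unfolding truncated_order_complex_def by blast
  fix x y assume xy: "x \<in> C" "y \<in> C"
  obtain a where a: "a \<in> C" "\<And>z. z \<in> C \<Longrightarrow> (a, z) \<in> le"
    using chain_min[OF chain] xy by blast
  obtain b where b: "b \<in> C" "\<And>z. z \<in> C \<Longrightarrow> (z, b) \<in> le"
    using chain_max[OF chain] xy by blast
  have "int (r b) - int (r a) \<le> int k"
    using C a b unfolding truncated_order_complex_def by blast
  moreover have "r a \<le> r x" "r y \<le> r b"
    using a(2)[OF xy(1)] b(2)[OF xy(2)] xy a(1) b(1) rank_mono chain_subset_P[OF chain] by blast+
  ultimately show "r y \<le> r x + k"
    by linarith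
next
  assume "C \<in> order_complex P le \<and> (\<forall>x\<in>C. \<forall>y\<in>C. r y \<le> r x + k)"
  then show "C \<in> truncated_order_complex P le r k"
    unfolding truncated_order_complex_def by force
qed

text \<open>This is the set \<open>F[i]\<close> of the overview. It makes sense for every
  \<open>i\<close>, but only \<open>i + k \<le> n\<close> guarantees that all \<open>k + 1\<close>
  ranks are present.\<close>

definition window :: "nat \<Rightarrow> 'a set \<Rightarrow> nat \<Rightarrow> 'a set" where
  "window k F i = {x \<in> F. i \<le> r x \<and> r x \<le> i + k}"

lemma window_subset: "window k F i \<subseteq> F"
  unfolding window_def by (rule Collect_restrict)

lemma window_ranks:
  assumes F: "F \<in> facets (order_complex P le)" and "i + k \<le> n"
  shows "r ` window k F i = {i..i + k}"
proof -
  have "{i..i + k} \<subseteq> r ` F"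
    using maximal_chain_ranks[OF F] assms(2) unfolding bij_betw_def by auto
  then show ?thesis
    unfolding window_def by auto
qed

lemma card_window:
  assumes F: "F \<in> facets (order_complex P le)" and "i + k \<le> n"
  shows "card (window k F i) = k + 1"
proof -
  have "inj_on r (window k F i)"
    by (rule inj_on_subset[OF chain_rank_inj[OF maximal_chain_chain[OF F]] window_subset])
  from card_image[OF this] show ?thesis
    using window_ranks[OF assms] by simp
qed

lemma window_truncated:
  assumes "F \<in> facets (order_complex P le)"
  shows "window k F i \<in> truncated_order_complex P le r k"
  unfolding truncated_iff
proof (intro conjI ballI)
  show "window k F i \<in> order_complex P le"
    by (rule chain_subset[OF maximal_chain_chain[OF assms] window_subset])
qed (simp add: window_def)

lemma truncated_subset_window:
  assumes "D \<in> truncated_order_complex P le r k" and "k \<le> n"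
  obtains F i where "F \<in> facets (order_complex P le)" "i + k \<le> n" "D \<subseteq> window k F i"
proof -
  have D: "D \<in> order_complex P le" "\<And>x y. x \<in> D \<Longrightarrow> y \<in> D \<Longrightarrow> r y \<le> r x + k"
    using assms(1) truncated_iff[of D k] by auto
  obtain F where F: "F \<in> facets (order_complex P le)" "D \<subseteq> F"
    using facet_extension[OF finite_order_complex D(1)] .
  \<comment> \<open>The natural start is the least rank in \<open>D\<close>. If it exceeds
    \<open>n - k\<close>, the topmost full window still contains \<open>D\<close>, because no rank
    exceeds \<open>n\<close>. For empty \<open>D\<close> the value of \<open>Min\<close> is
    irrelevant and the cap alone ensures \<open>i + k \<le> n\<close>.\<close>
  define i where "i = min (Min (r ` D)) (n - k)"
  have "D \<subseteq> window k F i"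
  proof
    fix y assume y: "y \<in> D"
    have fin: "finite (r ` D)"
      using chain_finite[OF D(1)] by simp
    then have "Min (r ` D) \<in> r ` D"
      using y by (intro Min_in) auto
    then obtain x where x: "x \<in> D" "Min (r ` D) = r x"
      by blast
    have "r y \<in> {0..n}"
      using bij_betw_apply[OF maximal_chain_ranks[OF F(1)]] F(2) y by blast
    then have "r y \<le> n"
      by simp
    moreover have "r x \<le> r y"
      using x y fin by (metis Min_le imageI)
    ultimately show "y \<in> window k F i"
      using D(2)[OF x(1) y] F(2) y x(2) \<open>k \<le> n\<close> unfolding window_def i_def by auto
  qed
  moreover have "i + k \<le> n"
    using \<open>k \<le> n\<close> unfolding i_def by simp
  ultimately show thesis
    using that F(1) by blast
qed

lemma window_finite: "F \<in> facets (order_complex P le) \<Longrightarrow> finite (window k F i)"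
  unfolding window_def using chain_finite[OF maximal_chain_chain] by simp

text \<open>Every simplex of the truncation lies in a full window, and all full windows have
  \<open>k + 1\<close> elements, so none properly contains another.\<close>

lemma facets_truncated:
  assumes "k \<le> n"
  shows "facets (truncated_order_complex P le r k) =
    {window k F i | F i. F \<in> facets (order_complex P le) \<and> i + k \<le> n}" (is "_ = ?W")
proof
  show "facets (truncated_order_complex P le r k) \<subseteq> ?W"
  proof
    fix G assume G: "G \<in> facets (truncated_order_complex P le r k)"
    then have "G \<in> truncated_order_complex P le r k"
      unfolding facets_def by blast
    then obtain F i where F: "F \<in> facets (order_complex P le)" "i + k \<le> n" "G \<subseteq> window k F i"
      using truncated_subset_window[OF _ assms] by blast
    then have "window k F i = G"
      using G window_truncated[OF F(1), of k i] unfolding facets_def by blast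
    with F show "G \<in> ?W" by blast
  qed
  show "?W \<subseteq> facets (truncated_order_complex P le r k)"
  proof clarify
    fix F i assume F: "F \<in> facets (order_complex P le)" "i + k \<le> n"
    have "D = window k F i" if D: "D \<in> truncated_order_complex P le r k" "window k F i \<subseteq> D" for D
    proof -
      obtain F' i' where F': "F' \<in> facets (order_complex P le)" "i' + k \<le> n" "D \<subseteq> window k F' i'"
        using truncated_subset_window[OF D(1) assms] .
      have "window k F i = window k F' i'"
        using card_subset_eq[OF window_finite[OF F'(1)]] D(2) F'(3) card_window[OF F] card_window[OF F'(1,2)]
        by (metis subset_trans)
      with D(2) F'(3) show ?thesis by blast
    qed
    with window_truncated[OF F(1)] show "window k F i \<in> facets (truncated_order_complex P le r k)"
      unfolding facets_def by blast
  qed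
qed

section \<open>Ordering the facets of the truncation\<close>

lemma Min_rank_window:
  assumes "F \<in> facets (order_complex P le)" and "i + k \<le> n"
  shows "Min (r ` window k F i) = i"
  unfolding window_ranks[OF assms] by (rule Min_eqI) auto

lemma simplicial_truncated: "simplicial_complex (truncated_order_complex P le r k)"
  unfolding simplicial_complex_def
proof (intro conjI ballI allI impI)
  show "{} \<in> truncated_order_complex P le r k"
    unfolding truncated_iff by (simp add: order_complex_def Chains_def)
next
  fix F assume "F \<in> truncated_order_complex P le r k"
  then have F: "F \<in> order_complex P le" "\<forall>x\<in>F. \<forall>y\<in>F. r y \<le> r x + k"
    unfolding truncated_iff by blast+
  then show "finite F"
    using chain_finite by blast
  fix G assume "G \<subseteq> F"
  with F show "G \<in> truncated_order_complex P le r k"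
    unfolding truncated_iff using chain_subset[OF F(1)] by blast
qed

lemma finite_truncated: "finite (truncated_order_complex P le r k)"
  by (rule finite_subset[OF _ finite_order_complex]) (auto simp: truncated_iff)

lemma shellable_truncated:
  assumes "shelling (order_complex P le) Fs" and "k \<le> n"
  shows "shellable (truncated_order_complex P le r k)"
proof -
  let ?T = "truncated_order_complex P le r k"
  have set: "set Fs = facets (order_complex P le)"
    using assms unfolding shelling_def by blast
  define first where "first G = (LEAST j. j < length Fs \<and> G \<subseteq> Fs ! j)" for G
  define low where "low G = Min (r ` G)" for G
  \<comment> \<open>This encodes the lexicographic order on \<open>(first G, low G)\<close> in one
    number: on facets \<open>low G \<le> n\<close>, so the factor \<open>n + 1\<close> keeps the
    first component dominant.\<close>
  define key where "key G = first G * (n + 1) + low G" for G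
  have first_le: "first G \<le> j" if "j < length Fs" "G \<subseteq> Fs ! j" for G j
    unfolding first_def using that by (simp add: Least_le)
  have facet_nth: "Fs ! j \<in> facets (order_complex P le)" if "j < length Fs" for j
    using that set nth_mem by blast
  have window_facet: "window k (Fs ! j) i \<in> facets ?T" if "j < length Fs" "i + k \<le> n" for i j
    using facets_truncated[OF assms(2)] facet_nth that by blast
  \<comment> \<open>Only an upper bound holds: the same window may already occur in an earlier
    maximal chain.\<close>
  have first_window: "first (window k (Fs ! j) i) \<le> j" if "j < length Fs" for i j
    using first_le[OF that] by (simp add: window_def)
  have low_window: "low (window k (Fs ! j) i) = i" if "j < length Fs" "i + k \<le> n" for i j
    using Min_rank_window[OF facet_nth] that by (simp add: low_def)
  \<comment> \<open>The pair \<open>(first G, low G)\<close> recovers \<open>G\<close>, since the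
    inclusion of \<open>G\<close> in the corresponding window is between sets of equal size.
    Injectivity of \<open>key\<close> rests on this.\<close>
  have facet: "first G < length Fs \<and> low G + k \<le> n \<and> G = window k (Fs ! first G) (low G)"
    if G: "G \<in> facets ?T" for G
  proof -
    obtain F i where F: "F \<in> facets (order_complex P le)" "i + k \<le> n" "G = window k F i"
      using G facets_truncated[OF assms(2)] by blast
    obtain j where "j < length Fs" "F = Fs ! j"
      using F(1) set by (metis in_set_conv_nth)
    then have "j < length Fs \<and> G \<subseteq> Fs ! j"
      using F(3) by (auto simp: window_def)
    then have first: "first G < length Fs \<and> G \<subseteq> Fs ! first G"
      unfolding first_def by (rule LeastI)
    have low: "low G = i"
      using Min_rank_window F by (simp add: low_def)
    have "G \<subseteq> window k (Fs ! first G) i"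
      using first F(3) by (auto simp: window_def)
    moreover have "card G = card (window k (Fs ! first G) i)"
      using card_window[OF facet_nth] card_window[OF F(1)] first F by simp
    ultimately have "G = window k (Fs ! first G) i"
      using card_subset_eq[OF window_finite[OF facet_nth]] first by blast
    with first F low show ?thesis by simp
  qed
  \<comment> \<open>The weak inequality in the second alternative matches
    \<open>first_window\<close>, which does not give the exact value of
    \<open>first\<close>.\<close>
  have key_lessI: "key H < key G"
    if "H \<in> facets ?T" "first H < first G \<or> first H \<le> first G \<and> low H < low G" for G H
  proof (cases "first H < first G")
    case True
    have "low H < n + 1"
      using facet that by fastforce
    then have "key H < Suc (first H) * (n + 1)"
      by (simp add: key_def)
    also have "\<dots> \<le> key G"
      using True mult_le_mono1[of "Suc (first H)" "first G" "n + 1"] by (simp add: key_def)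
    finally show ?thesis .
  next
    case False
    with that show ?thesis by (simp add: key_def)
  qed
  have key_lessD: "first H < first G \<or> first H = first G \<and> low H < low G"
    if "G \<in> facets ?T" "key H < key G" for G H
  proof (cases "first G" "first H" rule: linorder_cases)
    case less
    then show ?thesis using key_lessI[OF that(1), of H] that(2) by simp
  next
    case equal
    then show ?thesis using that(2) by (simp add: key_def)
  qed simp
  have inj: "inj_on key (facets ?T)"
  proof (rule inj_onI)
    fix G H assume GH: "G \<in> facets ?T" "H \<in> facets ?T" "key G = key H"
    then have "first G = first H" "low G = low H"
      using key_lessI[of G H] key_lessI[of H G] by (metis less_irrefl linorder_less_linear order.refl)+
    then show "G = H"
      using facet GH by metis
  qed
  have "\<exists>x\<in>G. \<exists>K\<in>facets ?T. key K < key G \<and> H \<inter> G \<subseteq> G - {x} \<and> G - {x} \<subseteq> K"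
    if GH: "G \<in> facets ?T" "H \<in> facets ?T" "key H < key G" for G H
  proof -
    define j where "j = first G"
    define i where "i = low G"
    have G: "j < length Fs" "i + k \<le> n" "G = window k (Fs ! j) i"
      using facet[OF GH(1)] by (auto simp: i_def j_def)
    have H: "first H < length Fs" "H = window k (Fs ! first H) (low H)"
      using facet[OF GH(2)] by auto
    consider "first H < j" | "first H = j" "low H < i"
      using key_lessD[OF GH(1,3)] by (auto simp: i_def j_def)
    then show ?thesis
    proof cases
      case 1
      obtain x m where xm: "x \<in> Fs ! j" "m < j" "Fs ! first H \<inter> Fs ! j \<subseteq> Fs ! j - {x}"
        "Fs ! j - {x} \<subseteq> Fs ! m"
        using shelling_exchange[OF assms(1) chain_finite[OF maximal_chain_chain] 1 G(1)] by blast
      have m: "m < length Fs"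
        using xm G by simp
      \<comment> \<open>Otherwise \<open>first G\<close> would be at most \<open>m\<close>. Since
        \<open>Fs ! m\<close> contains all of \<open>Fs ! j\<close> except possibly
        \<open>x\<close>, the missing element of \<open>G\<close> can only be
        \<open>x\<close>.\<close>
      have "\<not> G \<subseteq> Fs ! m"
        using first_le[OF m, of G] xm(2) by (auto simp: j_def)
      then have "x \<in> G"
        using xm(4) unfolding G(3) window_def by blast
      moreover have "H \<inter> G \<subseteq> G - {x}"
        using xm(3) H(2) unfolding G(3) window_def by blast
      moreover have "G - {x} \<subseteq> window k (Fs ! m) i"
        using xm(4) unfolding G(3) window_def by blast
      moreover have "key (window k (Fs ! m) i) < key G"
        using key_lessI[OF window_facet[OF m G(2)]] first_window[OF m, of i] xm(2)
        by (simp add: j_def)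
      ultimately show ?thesis
        using window_facet[OF m G(2)] by blast
    next
      case 2
      have "i + k \<in> r ` G"
        using window_ranks[OF facet_nth[OF G(1)] G(2)] G(3) by simp
      then obtain x where x: "x \<in> G" "r x = i + k"
        by auto
      \<comment> \<open>Ranks in \<open>H\<close> reach at most \<open>low H + k\<close>, which is
        below \<open>i + k\<close>.\<close>
      have "x \<notin> H"
        using 2 x(2) by (subst H(2)) (simp add: window_def)
      then have "H \<inter> G \<subseteq> G - {x}"
        by blast
      \<comment> \<open>Here \<open>low H < i\<close> makes \<open>i\<close> positive, so
        \<open>i - 1\<close> is a genuine predecessor. Moving the window down by one loses only rank
        \<open>i + k\<close>, attained in \<open>Fs ! j\<close> by \<open>x\<close> alone.\<close>
      moreover have "G - {x} \<subseteq> window k (Fs ! j) (i - 1)"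
      proof
        fix y assume y: "y \<in> G - {x}"
        have "inj_on r (Fs ! j)"
          using chain_rank_inj maximal_chain_chain facet_nth[OF G(1)] by blast
        then have "r y \<noteq> i + k"
          using x y G(3) by (auto simp: window_def inj_on_def)
        with y show "y \<in> window k (Fs ! j) (i - 1)"
          using G(3) by (auto simp: window_def)
      qed
      moreover have i1: "i - 1 + k \<le> n"
        using G(2) by simp
      moreover have "key (window k (Fs ! j) (i - 1)) < key G"
        using key_lessI[OF window_facet[OF G(1) i1]] first_window[OF G(1), of "i - 1"]
          low_window[OF G(1) i1] 2 by (simp add: i_def j_def)
      ultimately show ?thesis
        using window_facet[OF G(1) i1] x(1) by blast
    qed
  qed
  then show ?thesis
    using shellable_of_key[OF finite_truncated simplicial_truncated inj] by blast
qed

end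

theorem theorem4p5:
  fixes P :: "'a set" and le :: "'a rel" and r :: "'a \<Rightarrow> nat" and n k :: nat
  assumes "graded_poset P le r n"
    and "shellable (order_complex P le)"
    and "k \<le> n"
  shows "shellable (truncated_order_complex P le r k)"
proof -
  interpret graded P le r n
    by standard (fact assms(1))
  show ?thesis
    using assms(2,3) shellable_truncated unfolding shellable_def by blast
qed

end
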